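(* Let $\rho$ be a density matrix on $L^2(\mathbf{R}^d)^{\otimes N}$ with integral kernel $\rho(X;Y)$, let $i,j\in\{1,\dots,N\}$, and let $\widetilde W[\rho](Z,\bar Z)$ be its Husimi function expressed in the complex variables $Z=(z_1,\dots,z_N)$, $z_l=q_l+ip_l$, $\bar z_l=q_l-ip_l$. Then for all $Z\in\mathbf{C}^{dN}$ $$\widetilde W[U_{i\leftrightarrow j}\rho](Z,\bar Z)=e^{-\frac{(\bar z_i-\bar z_j)\cdot(z_i-z_j)}{2\hbar}}\;\widetilde W[\rho](Z,\bar Z)\big|_{z_i\leftrightarrow z_j},$$ $$\widetilde W[V_{i\leftrightarrow j}\rho](Z,\bar Z)=e^{-\frac{|z_i-z_j|^2}{2\hbar}}\;\widetilde W[\rho](Z,\bar Z)\big|_{\bar z_i\leftrightarrow \bar z_j}.$$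
   Context: Fix $\hbar>0$ and integers $d,N\ge 1$. A density matrix is a positive trace-one operator $\rho$ on $L^2(\mathbf{R}^d)^{\otimes N}=L^2(\mathbf{R}^{dN})$, with integral kernel $\rho(X;Y)$, $X=(x_1,\dots,x_N)$, $Y=(y_1,\dots,y_N)$, $x_l,y_l\in\mathbf{R}^d$. $U_{i\leftrightarrow j}\rho$ is the operator whose kernel is $\rho(X;Y)$ with $y_i$ and $y_j$ exchanged, and $V_{i\leftrightarrow j}\rho$ is the operator whose kernel is $\rho(X;Y)$ with $x_i$ and $x_j$ exchanged. For $Z=q+ip\in\mathbf{C}^{dN}$ ($q,p\in\mathbf{R}^{dN}$), the coherent state is $\varphi_Z(x)=(\pi\hbar)^{-dN/4}e^{-\frac{(x-q)^2}{2\hbar}}e^{i\frac{p\cdot x}{\hbar}}$, $x\in\mathbf{R}^{dN}$. For a density matrix, and more generally any trace-class operator $\rho$, the Husimi function is $$\widetilde W[\rho](Z,\bar Z)=\frac{1}{(2\pi\hbar)^{dN}}\langle\varphi_Z|\rho|\varphi_Z\rangle=\frac{1}{(2\pi\hbar)^{dN}}\iint\overline{\varphi_Z(X)}\,\rho(X;Y)\,\varphi_Z(Y)\,dX\,dY .$$ It is the restriction to $\{Z'=\bar Z\}$ of a unique entire function $\widetilde W[\rho](Z,Z')$ of $(Z,Z')\in\mathbf{C}^{dN}\times\mathbf{C}^{dN}$. The notation $|_{z_i\leftrightarrow z_j}$ means: exchange the components $z_i$ and $z_j$ in the argument $Z$ of this entire function, leaving the argument $Z'$ unchanged, and then set $Z'=\bar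 Z$; $|_{\bar z_i\leftrightarrow\bar z_j}$ means: exchange the $i$-th and $j$-th components of $Z'$, leaving $Z$ unchanged, and set $Z'=\bar Z$. For $a,b\in\mathbf{C}^d$, $a\cdot b=\sum_k a_kb_k$ (bilinear). *)

theory Defs
  imports "HOL-Analysis.Analysis" "HOL-Library.Nonpos_Ints"
begin

text \<open>
  The index type \<open>'d\<close> has \<open>d\<close> elements and \<open>'n\<close> has \<open>N\<close> elements, so \<open>real^'d^'n\<close> is the
  configuration space: \<open>X $ l\<close> is the position of the \<open>l\<close>-th particle. Square-integrable functions
  are handled through Borel representatives, and all identities between them are understood
  almost everywhere.
\<close>

type_synonym 'v wavefun = "'v \<Rightarrow> complex"
type_synonym 'v operator = "'v wavefun \<Rightarrow> 'v wavefun"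

definition L2 :: "('v::euclidean_space) wavefun set" where
  "L2 = {f \<in> borel_measurable lborel. integrable lborel (\<lambda>x. (cmod (f x))\<^sup>2)}"

definition l2_inner :: "('v::euclidean_space) wavefun \<Rightarrow> 'v wavefun \<Rightarrow> complex" where
  "l2_inner f g = (LINT x|lborel. cnj (f x) * g x)"

definition l2_norm :: "('v::euclidean_space) wavefun \<Rightarrow> real" where
  "l2_norm f = sqrt (LINT x|lborel. (cmod (f x))\<^sup>2)"

text \<open>
  Linearity and boundedness together imply that such a map sends almost everywhere equal
  functions to almost everywhere equal functions, so it acts on equivalence classes.
  The values outside \<^const>\<open>L2\<close> are irrelevant.
\<close>

definition bounded_l2_operator :: "('v::euclidean_space) operator \<Rightarrow> bool" where
  "bounded_l2_operator T \<longleftrightarrow>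
     (\<forall>f\<in>L2. T f \<in> L2) \<and>
     (\<forall>f\<in>L2. \<forall>g\<in>L2. \<forall>a b. AE x in lborel.
        T (\<lambda>y. a * f y + b * g y) x = a * T f x + b * T g x) \<and>
     (\<exists>B. \<forall>f\<in>L2. l2_norm (T f) \<le> B * l2_norm f)"

definition positive_l2_operator :: "('v::euclidean_space) operator \<Rightarrow> bool" where
  "positive_l2_operator T \<longleftrightarrow> bounded_l2_operator T \<and> (\<forall>f\<in>L2. l2_inner f (T f) \<in> \<real>\<^sub>\<ge>\<^sub>0)"

definition orthonormal_basis :: "(nat \<Rightarrow> ('v::euclidean_space) wavefun) \<Rightarrow> bool" where
  "orthonormal_basis e \<longleftrightarrow>
     (\<forall>k. e k \<in> L2) \<and>
     (\<forall>k l. l2_inner (e k) (e l) = (if k = l then 1 else 0)) \<and>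
     (\<forall>f\<in>L2. (\<forall>k. l2_inner (e k) f = 0) \<longrightarrow> (AE x in lborel. f x = 0))"

text \<open>
  For a positive operator the series of diagonal elements does not depend on the orthonormal
  basis, and its convergence is the trace-class property.
\<close>

definition density_matrix :: "('v::euclidean_space) operator \<Rightarrow> bool" where
  "density_matrix T \<longleftrightarrow> positive_l2_operator T \<and>
     (\<forall>e. orthonormal_basis e \<longrightarrow> (\<lambda>k. l2_inner (e k) (T (e k))) sums 1)"

type_synonym 'v kernel = "'v \<Rightarrow> 'v \<Rightarrow> complex"

definition kernel_operator :: "('v::euclidean_space) kernel \<Rightarrow> 'v operator" where
  "kernel_operator K f = (\<lambda>X. LINT Y|lborel. K X Y * f Y)"

text \<open>
  A trace-class operator is Hilbert--Schmidt, so its integral kernel is the square-integrable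
  function on the product space (unique up to null sets) that represents it.
\<close>

definition has_integral_kernel :: "('v::euclidean_space) operator \<Rightarrow> 'v kernel \<Rightarrow> bool" where
  "has_integral_kernel T K \<longleftrightarrow>
     (\<lambda>(X, Y). K X Y) \<in> L2 \<and>
     (\<forall>f\<in>L2. AE X in lborel. T f X = kernel_operator K f X)"

definition exchange :: "'n \<Rightarrow> 'n \<Rightarrow> 'a^'n \<Rightarrow> 'a^'n" where
  "exchange i j X = (\<chi> l. X $ Transposition.transpose i j l)"

definition U_exchange ::
  "'n \<Rightarrow> 'n \<Rightarrow> (real^'d^'n) kernel \<Rightarrow> (real^'d^'n) operator" where
  "U_exchange i j K = kernel_operator (\<lambda>X Y. K X (exchange i j Y))"

definition V_exchange ::
  "'n \<Rightarrow> 'n \<Rightarrow> (real^'d^'n) kernel \<Rightarrow> (real^'d^'n) operator" where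
  "V_exchange i j K = kernel_operator (\<lambda>X Y. K (exchange i j X) Y)"

definition Re_vec :: "complex^'d^'n \<Rightarrow> real^'d^'n" where
  "Re_vec Z = (\<chi> l k. Re (Z $ l $ k))"

definition Im_vec :: "complex^'d^'n \<Rightarrow> real^'d^'n" where
  "Im_vec Z = (\<chi> l k. Im (Z $ l $ k))"

definition cnj_vec :: "complex^'d^'n \<Rightarrow> complex^'d^'n" where
  "cnj_vec Z = (\<chi> l k. cnj (Z $ l $ k))"

definition cscale :: "complex \<Rightarrow> complex^'d^'n \<Rightarrow> complex^'d^'n" where
  "cscale c Z = (\<chi> l k. c * Z $ l $ k)"

definition bilinear_dot :: "complex^'d \<Rightarrow> complex^'d \<Rightarrow> complex" where
  "bilinear_dot a b = (\<Sum>k\<in>UNIV. a $ k * b $ k)"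

definition coherent_state :: "real \<Rightarrow> complex^'d^'n \<Rightarrow> (real^'d^'n) wavefun" where
  "coherent_state hbar Z x =
     complex_of_real ((pi * hbar) powr (- (real (CARD('d) * CARD('n)) / 4))) *
     complex_of_real (exp (- ((norm (x - Re_vec Z))\<^sup>2 / (2 * hbar)))) *
     exp (\<i> * complex_of_real ((Im_vec Z \<bullet> x) / hbar))"

definition husimi :: "real \<Rightarrow> (real^'d^'n) operator \<Rightarrow> complex^'d^'n \<Rightarrow> complex" where
  "husimi hbar T Z =
     l2_inner (coherent_state hbar Z) (T (coherent_state hbar Z)) /
     complex_of_real ((2 * pi * hbar) ^ (CARD('d) * CARD('n)))"

text \<open>
  Holomorphy in several variables: real Frechet differentiability with a complex-linear derivative.
\<close>

definition entire2 :: "(complex^'d^'n \<Rightarrow> complex^'d^'n \<Rightarrow> complex) \<Rightarrow> bool" where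
  "entire2 F \<longleftrightarrow>
     (\<forall>P. \<exists>D. ((\<lambda>(Z, Z'). F Z Z') has_derivative D) (at P) \<and>
        (\<forall>c V V'. D (cscale c V, cscale c V') = c * D (V, V')))"

text \<open>
  The set of points \<open>(Z, cnj_vec Z)\<close> is totally real of maximal dimension, so it determines an
  entire function of \<open>(Z, Z')\<close>; for trace-class operators the extension exists.
\<close>

definition husimi_ext ::
  "real \<Rightarrow> (real^'d^'n) operator \<Rightarrow> complex^'d^'n \<Rightarrow> complex^'d^'n \<Rightarrow> complex" where
  "husimi_ext hbar T =
     (THE F. entire2 F \<and> (\<forall>Z. F Z (cnj_vec Z) = husimi hbar T Z))"

end

theory Submission
  imports Defs "HOL-Probability.Distributions" "HOL-Complex_Analysis.Conformal_Mappings"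
begin

text \<open>
  Completing the square, the coherent state at \<open>Z\<close> is \<open>a exp (-\<bar>Re Z\<bar>\<^sup>2/(2 hbar)) exp ((x\<cdot>Z - \<bar>x\<bar>\<^sup>2/2)/hbar)\<close>.
  Hence the Husimi function at \<open>Z\<close> is the value at \<open>Z' = cnj Z\<close> of
  \<open>F(Z,Z') = c exp (-(Z+Z')\<cdot>(Z+Z')/(4 hbar)) \<integral>\<integral> exp ((X\<cdot>Z' - \<bar>X\<bar>\<^sup>2/2)/hbar) K(X;Y) exp ((Y\<cdot>Z - \<bar>Y\<bar>\<^sup>2/2)/hbar) dX dY\<close>,
  which is entire because \<open>K\<close> is square integrable; by uniqueness it is the extension of the Husimi
  function. A change of variables moves the exchange from the kernel to one of the two
  coherent states, that is, to the argument \<open>Z\<close> or \<open>Z'\<close> of the double integral. The Gaussian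
  prefactor does not see this exchange, since \<open>\<bar>Re Z\<bar>\<close> is permutation invariant, whereas
  \<open>(Z+Z')\<cdot>(Z+Z')\<close> changes by \<open>-2 (z\<^sub>i - z\<^sub>j)\<cdot>(z'\<^sub>i - z'\<^sub>j)\<close>: this is the exponential factor.
\<close>

section \<open>Integrability of Gaussians and differentiation of exponential integrals\<close>

text \<open>The integrand factorises over the coordinates, so Tonelli reduces the claim to dimension
  one, where it is a rescaled normal density.\<close>

lemma integrable_gaussian:
  fixes a :: real
  assumes "a > 0"
  shows "integrable lborel (\<lambda>x::'a::euclidean_space. exp (- (a * (norm x)\<^sup>2)))"
proof -
  have 1: "integrable lborel (\<lambda>t::real. exp (- (a * t\<^sup>2)))"
  proof -
    define s where "s = sqrt (1 / (2 * a))"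
    have s: "s > 0" "s\<^sup>2 = 1 / (2 * a)"
      using assms by (auto simp: s_def)
    have "integrable lborel (\<lambda>t. sqrt (2 * pi * s\<^sup>2) * normal_density 0 s t)"
      by (intro integrable_mult_right integrable_normal_density s)
    moreover have "sqrt (2 * pi * s\<^sup>2) * normal_density 0 s t = exp (- (a * t\<^sup>2))" for t
      using assms s by (simp add: normal_density_def)
    ultimately show ?thesis by simp
  qed
  have eq: "exp (- (a * (norm x)\<^sup>2)) = (\<Prod>b\<in>Basis. exp (- (a * (x \<bullet> b)\<^sup>2)))" for x :: 'a
    unfolding power2_norm_eq_inner euclidean_inner[of x x]
    by (simp add: exp_sum[symmetric] power2_eq_square sum_negf[symmetric] sum_distrib_left)
  have "(\<integral>\<^sup>+x. ennreal (exp (- (a * (norm (x::'a))\<^sup>2))) \<partial>lborel)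
      = (\<Prod>b\<in>(Basis::'a set). \<integral>\<^sup>+t. ennreal (exp (- (a * t\<^sup>2))) \<partial>lborel)"
    unfolding eq prod_ennreal[symmetric, OF exp_ge_zero] by (rule nn_integral_lborel_prod) auto
  also have "\<dots> < \<infinity>"
    using 1 by (simp add: nn_integral_eq_integral ennreal_power ennreal_less_top)
  finally show ?thesis
    by (intro integrableI_bounded) auto
qed

text \<open>Half of the Gaussian absorbs the linear term: completing the square in
  \<open>norm x\<close> leaves a constant times a Gaussian of rate \<open>a / 2\<close>.\<close>

lemma integrable_gaussian_exp_norm:
  fixes a c :: real
  assumes "a > 0"
  shows "integrable lborel (\<lambda>x::'a::euclidean_space. exp (c * norm x - a * (norm x)\<^sup>2))"
proof (rule Bochner_Integration.integrable_bound)
  show "integrable lborel (\<lambda>x::'a. exp (c\<^sup>2 / (2 * a)) * exp (- (a / 2 * (norm x)\<^sup>2)))"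
    using assms by (intro integrable_mult_right integrable_gaussian) auto
  have "c * norm x - a * (norm x)\<^sup>2 \<le> c\<^sup>2 / (2 * a) - a / 2 * (norm x)\<^sup>2" for x :: 'a
  proof -
    have "0 \<le> (a * norm x - c)\<^sup>2 / (2 * a)" using assms by simp
    also have "\<dots> = c\<^sup>2 / (2 * a) - a / 2 * (norm x)\<^sup>2 - (c * norm x - a * (norm x)\<^sup>2)"
      using assms by (simp add: field_simps power2_eq_square)
    finally show ?thesis by simp
  qed
  then show "AE x::'a in lborel. norm (exp (c * norm x - a * (norm x)\<^sup>2))
      \<le> norm (exp (c\<^sup>2 / (2 * a)) * exp (- (a / 2 * (norm x)\<^sup>2)))"
    by (simp add: exp_add[symmetric])
qed measurable

lemma integrable_L2_mult:
  fixes f g :: "'v::euclidean_space wavefun"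
  assumes "f \<in> L2" "g \<in> L2"
  shows "integrable lborel (\<lambda>x. f x * g x)"
proof (rule Bochner_Integration.integrable_bound)
  show "integrable lborel (\<lambda>x. (cmod (f x))\<^sup>2 + (cmod (g x))\<^sup>2)"
    using assms by (auto simp: L2_def)
  have [measurable]: "f \<in> borel_measurable borel" "g \<in> borel_measurable borel"
    using assms by (auto simp: L2_def)
  show "(\<lambda>x. f x * g x) \<in> borel_measurable lborel" by measurable
  have "cmod (f x * g x) \<le> (cmod (f x))\<^sup>2 + (cmod (g x))\<^sup>2" for x
  proof -
    have "0 \<le> cmod (f x) * cmod (g x)" by simp
    then show ?thesis
      using sum_squares_bound[of "cmod (f x)" "cmod (g x)"] unfolding norm_mult by linarith
  qed
  then show "AE x in lborel. norm (f x * g x) \<le> norm ((cmod (f x))\<^sup>2 + (cmod (g x))\<^sup>2)"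
    by simp
qed

text \<open>
  The remainder is estimated directly by \<open>\<bar>exp a - 1 - a\<bar> \<le> \<bar>a\<bar>\<^sup>2 exp \<bar>a\<bar>\<close>, so no theorem on
  differentiation under the integral sign is needed.
\<close>

lemma has_derivative_exp_integral:
  fixes L :: "'a \<Rightarrow> 'w::euclidean_space \<Rightarrow> complex" and g :: "'a \<Rightarrow> complex" and N :: "'a \<Rightarrow> real"
  assumes g[measurable]: "g \<in> borel_measurable M" and N[measurable]: "N \<in> borel_measurable M"
    and L[measurable]: "\<And>W. (\<lambda>u. L u W) \<in> borel_measurable M"
    and lin: "\<And>u. linear (L u)"
    and bound: "\<And>u W. norm (L u W) \<le> N u * norm W"
    and int: "\<And>c. integrable M (\<lambda>u. norm (g u) * exp (c * N u))"
  shows "((\<lambda>W. LINT u|M. g u * exp (L u W)) has_derivative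
          (\<lambda>V. LINT u|M. g u * L u V * exp (L u W))) (at W)"
proof -
  have N0: "N u \<ge> 0" for u
  proof -
    \<comment> \<open>A basis vector has norm one, so \<open>bound\<close> at it exhibits
      \<open>N u\<close> as an upper bound of a norm.\<close>
    obtain b :: 'w where "b \<in> Basis" using nonempty_Basis by blast
    then show ?thesis using bound[of u b] norm_ge_zero[of "L u b"]
      by (simp del: norm_ge_zero)
  qed
  have absL: "norm (exp (L u V)) \<le> exp (N u * norm V)" for u V
    using norm_exp[of "L u V"] bound[of u V] by (meson exp_le_cancel_iff order_trans)
  have intE: "integrable M (\<lambda>u. g u * exp (L u V))" for V
  proof (rule Bochner_Integration.integrable_bound[OF int[of "norm V"]])
    show "AE u in M. norm (g u * exp (L u V)) \<le> norm (norm (g u) * exp (norm V * N u))"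
      using absL[of _ V] by (simp add: norm_mult mult_left_mono mult.commute del: norm_exp_eq_Re)
  qed measurable
  have intD: "integrable M (\<lambda>u. g u * L u V * exp (L u W))" for V
  proof (rule Bochner_Integration.integrable_bound)
    \<comment> \<open>The extra 1 in the exponent pays for the linear factor \<open>L u V\<close>,
      through \<open>N u \<le> exp (N u)\<close>.\<close>
    show "integrable M (\<lambda>u. norm V * (norm (g u) * exp ((norm W + 1) * N u)))"
      by (intro integrable_mult_right int)
    have "norm (g u * L u V * exp (L u W)) \<le> norm V * (norm (g u) * exp ((norm W + 1) * N u))" for u
    proof -
      have "N u \<le> exp (N u)" using exp_ge_add_one_self[of "N u"] by linarith
      then have "norm (L u V) \<le> exp (N u) * norm V"
        using bound[of u V] by (meson mult_right_mono norm_ge_zero order_trans)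
      then have "norm (g u * L u V * exp (L u W)) \<le> norm (g u) * (exp (N u) * norm V) * exp (N u * norm W)"
        unfolding norm_mult by (intro mult_mono absL) auto
      also have "\<dots> = norm V * (norm (g u) * exp ((norm W + 1) * N u))"
        by (simp add: algebra_simps exp_add)
      finally show ?thesis .
    qed
    then show "AE u in M. norm (g u * L u V * exp (L u W)) \<le>
        norm (norm V * (norm (g u) * exp ((norm W + 1) * N u)))"
      by simp
  qed measurable
  have bl: "bounded_linear (\<lambda>V. LINT u|M. g u * L u V * exp (L u W))"
  proof -
    have "linear (\<lambda>V. LINT u|M. g u * L u V * exp (L u W))"
    proof (rule linearI)
      fix V V' c
      show "(LINT u|M. g u * L u (V + V') * exp (L u W)) =
          (LINT u|M. g u * L u V * exp (L u W)) + (LINT u|M. g u * L u V' * exp (L u W))"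
        by (subst Bochner_Integration.integral_add[symmetric])
          (auto simp: intD linear_add[OF lin] distrib_left distrib_right)
      show "(LINT u|M. g u * L u (c *\<^sub>R V) * exp (L u W)) = c *\<^sub>R (LINT u|M. g u * L u V * exp (L u W))"
        by (subst integral_scaleR_right[symmetric])
          (auto simp: linear_cmul[OF lin])
    qed
    then show ?thesis by (simp add: linear_linear)
  qed
  \<comment> \<open>In the exponent, \<open>norm W\<close> comes from \<open>exp (L u W)\<close>,
    one unit from \<open>exp (L u V)\<close> with \<open>norm V \<le> 1\<close>, and one unit,
    together with the factor 2, from \<open>(N u)\<^sup>2 \<le> 2 * exp (N u)\<close>.\<close>
  define C where "C = (LINT u|M. 2 * (norm (g u) * exp ((norm W + 2) * N u)))"
  have rem: "norm ((LINT u|M. g u * exp (L u W')) - (LINT u|M. g u * exp (L u W)) -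
      (LINT u|M. g u * L u (W' - W) * exp (L u W))) \<le> C * (norm (W' - W))\<^sup>2"
    if "norm (W' - W) \<le> 1" for W'
  proof -
    define V where "V = W' - W"
    have W': "W' = W + V" by (simp add: V_def)
    have V1: "norm V \<le> 1" using that by (simp add: V_def)
    have pt: "norm (g u * exp (L u W') - g u * exp (L u W) - g u * L u V * exp (L u W))
        \<le> (norm V)\<^sup>2 * (2 * (norm (g u) * exp ((norm W + 2) * N u)))" for u
    proof -
      have "N u * norm V \<le> N u"
        using V1 N0[of u] by (simp add: mult_left_le)
      then have nL: "norm (L u V) \<le> N u" using bound[of u V] by linarith
      have sq: "(N u)\<^sup>2 \<le> 2 * exp (N u)"
        using exp_lower_Taylor_quadratic[OF N0[of u]] N0[of u] by linarith
      have "norm (exp (L u V) - 1 - L u V) \<le> exp \<bar>Re (L u V)\<bar> * (norm (L u V))\<^sup>2"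
        using Taylor_exp[of "L u V" 1] by (simp add: power2_eq_square algebra_simps)
      also have "\<dots> \<le> exp (N u) * (N u * norm V)\<^sup>2"
        using bound[of u V] nL abs_Re_le_cmod[of "L u V"]
        by (intro mult_mono power_mono) auto
      also have "\<dots> = exp (N u) * (N u)\<^sup>2 * (norm V)\<^sup>2" by (simp add: power_mult_distrib)
      also have "\<dots> \<le> exp (N u) * (2 * exp (N u)) * (norm V)\<^sup>2"
        using sq by (intro mult_mono) auto
      finally have *: "norm (exp (L u V) - 1 - L u V) \<le> 2 * exp (2 * N u) * (norm V)\<^sup>2"
        by (simp add: exp_double power2_eq_square)
      have "g u * exp (L u W') - g u * exp (L u W) - g u * L u V * exp (L u W)
          = g u * exp (L u W) * (exp (L u V) - 1 - L u V)"
        by (simp add: W' linear_add[OF lin] exp_add algebra_simps)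
      also have "norm \<dots> \<le> norm (g u) * exp (N u * norm W) * (2 * exp (2 * N u) * (norm V)\<^sup>2)"
        unfolding norm_mult by (intro mult_mono absL *) auto
      also have "\<dots> = (norm V)\<^sup>2 * (2 * (norm (g u) * exp ((norm W + 2) * N u)))"
        by (simp add: algebra_simps exp_add)
      finally show ?thesis .
    qed
    have "(LINT u|M. g u * exp (L u W')) - (LINT u|M. g u * exp (L u W)) -
        (LINT u|M. g u * L u V * exp (L u W))
      = (LINT u|M. g u * exp (L u W') - g u * exp (L u W) - g u * L u V * exp (L u W))"
      by (simp add: intE intD)
    also have "norm \<dots> \<le> (LINT u|M. (norm V)\<^sup>2 * (2 * (norm (g u) * exp ((norm W + 2) * N u))))"
      by (intro order_trans[OF integral_norm_bound] integral_mono pt integrable_norm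
          Bochner_Integration.integrable_diff intE intD integrable_mult_right int)
    also have "\<dots> = C * (norm V)\<^sup>2" by (simp add: C_def)
    finally show ?thesis by (simp add: V_def)
  qed
  show ?thesis
  proof (rule has_derivativeI_sandwich[of 1])
    show "((\<lambda>W'. C * norm (W' - W)) \<longlongrightarrow> 0) (at W)"
      by (auto intro!: tendsto_eq_intros)
    fix W' assume "W' \<noteq> W" "dist W' W < 1"
    then show "norm ((LINT u|M. g u * exp (L u W')) - (LINT u|M. g u * exp (L u W)) -
        (LINT u|M. g u * L u (W' - W) * exp (L u W))) / norm (W' - W) \<le> C * norm (W' - W)"
      using rem[of W'] by (simp add: dist_norm divide_le_eq power2_eq_square mult.assoc)
  qed (use bl in auto)
qed

section \<open>Invariance of Lebesgue measure under coordinate permutations\<close>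

text \<open>The preimage of a box is a box with the same side lengths in another order, and Lebesgue
  measure is determined by its values on boxes.\<close>

lemma lborel_distr_permute_Basis:
  fixes f :: "'a::euclidean_space \<Rightarrow> 'a"
  assumes "linear f" and inv: "\<And>x. f (f x) = x"
    and adj: "\<And>x y. f x \<bullet> y = x \<bullet> f y" and basis: "f ` Basis = Basis"
  shows "distr lborel borel f = lborel"
proof (rule lborel_eqI[symmetric])
  have [measurable]: "f \<in> borel_measurable borel"
    using \<open>linear f\<close> by (intro borel_measurable_continuous_onI linear_continuous_on)
      (simp add: linear_linear)
  fix l u :: 'a
  assume lu: "\<And>b. b \<in> Basis \<Longrightarrow> l \<bullet> b \<le> u \<bullet> b"
  have fB: "f b \<in> Basis" if "b \<in> Basis" for b using basis that by blast
  have bij: "bij_betw f Basis Basis"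
    using basis inv by (auto simp: bij_betw_def intro: inj_on_inverseI)
  have "f -` box l u = box (f l) (f u)"
  proof (intro set_eqI iffI)
    fix x assume "x \<in> f -` box l u"
    then have "l \<bullet> f b < f x \<bullet> f b \<and> f x \<bullet> f b < u \<bullet> f b" if "b \<in> Basis" for b
      using fB[OF that] by (auto simp: mem_box)
    then show "x \<in> box (f l) (f u)" by (auto simp: mem_box adj inv)
  next
    fix x assume "x \<in> box (f l) (f u)"
    then have "f l \<bullet> f b < x \<bullet> f b \<and> x \<bullet> f b < f u \<bullet> f b" if "b \<in> Basis" for b
      using fB[OF that] by (auto simp: mem_box)
    then show "x \<in> f -` box l u" by (auto simp: mem_box adj inv)
  qed
  then have "emeasure (distr lborel borel f) (box l u) = emeasure lborel (box (f l) (f u))"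
    by (simp add: emeasure_distr)
  also have "\<dots> = (\<Prod>b\<in>Basis. (f u - f l) \<bullet> b)"
    using lu fB by (intro emeasure_lborel_box) (simp add: adj)
  also have "(\<Prod>b\<in>Basis. (f u - f l) \<bullet> b) = (\<Prod>b\<in>Basis. (u - l) \<bullet> f b)"
    by (simp add: linear_diff[OF \<open>linear f\<close>, symmetric] adj)
  also have "\<dots> = (\<Prod>b\<in>Basis. (u - l) \<bullet> b)"
    by (rule prod.reindex_bij_betw[OF bij])
  finally show "emeasure (distr lborel borel f) (box l u) = (\<Prod>b\<in>Basis. (u - l) \<bullet> b)" .
qed simp

section \<open>Bilinear pairings and entire functions of two vector variables\<close>

text \<open>No conjugation occurs, so the pairing is complex linear in \<open>Z\<close> and its
  exponential is holomorphic.\<close>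

definition real_dot :: "real^'d^'n \<Rightarrow> complex^'d^'n \<Rightarrow> complex" where
  "real_dot x Z = (\<Sum>l\<in>UNIV. \<Sum>k\<in>UNIV. of_real (x $ l $ k) * Z $ l $ k)"

definition complex_dot :: "complex^'d^'n \<Rightarrow> complex^'d^'n \<Rightarrow> complex" where
  "complex_dot Z W = (\<Sum>l\<in>UNIV. bilinear_dot (Z $ l) (W $ l))"

text \<open>This and the following closure rules show that the Gaussian prefactor is entire without
  an explicit derivative.\<close>

lemma entire2_const: "entire2 (\<lambda>Z Z'. c)"
  unfolding entire2_def case_prod_beta by (intro allI exI[of _ "\<lambda>_. 0"]) auto

lemma entire2_component_fst: "entire2 (\<lambda>(Z :: complex^'d^'n) Z'. Z $ l $ k)"
proof -
  have "((\<lambda>(Z, Z'). Z $ l $ k) has_derivative (\<lambda>(Z, Z'). Z $ l $ k)) (at P)"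
    for P :: "(complex^'d^'n) \<times> (complex^'d^'n)"
    unfolding case_prod_beta
    by (intro bounded_linear.has_derivative[OF bounded_linear_vec_nth] has_derivative_fst has_derivative_ident)
  then show ?thesis
    unfolding entire2_def by (intro allI exI conjI) (assumption, simp add: cscale_def)
qed

lemma entire2_component_snd: "entire2 (\<lambda>Z (Z' :: complex^'d^'n). Z' $ l $ k)"
proof -
  have "((\<lambda>(Z, Z'). Z' $ l $ k) has_derivative (\<lambda>(Z, Z'). Z' $ l $ k)) (at P)"
    for P :: "(complex^'d^'n) \<times> (complex^'d^'n)"
    unfolding case_prod_beta
    by (intro bounded_linear.has_derivative[OF bounded_linear_vec_nth] has_derivative_snd has_derivative_ident)
  then show ?thesis
    unfolding entire2_def by (intro allI exI conjI) (assumption, simp add: cscale_def)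
qed

lemma entire2_add:
  assumes "entire2 F" "entire2 G"
  shows "entire2 (\<lambda>Z Z'. F Z Z' + G Z Z')"
  unfolding entire2_def
proof
  fix P
  from assms obtain D E where
    D: "((\<lambda>(Z, Z'). F Z Z') has_derivative D) (at P)" "\<And>c V V'. D (cscale c V, cscale c V') = c * D (V, V')" and
    E: "((\<lambda>(Z, Z'). G Z Z') has_derivative E) (at P)" "\<And>c V V'. E (cscale c V, cscale c V') = c * E (V, V')"
    unfolding entire2_def by meson
  have "((\<lambda>(Z, Z'). F Z Z' + G Z Z') has_derivative (\<lambda>V. D V + E V)) (at P)"
    using has_derivative_add[OF D(1) E(1)] by (simp add: case_prod_beta')
  then show "\<exists>D. ((\<lambda>(Z, Z'). F Z Z' + G Z Z') has_derivative D) (at P) \<and>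
      (\<forall>c V V'. D (cscale c V, cscale c V') = c * D (V, V'))"
    using D(2) E(2) by (intro exI conjI) (assumption, simp add: algebra_simps)
qed

lemma entire2_mult:
  assumes "entire2 F" "entire2 G"
  shows "entire2 (\<lambda>Z Z'. F Z Z' * G Z Z')"
  unfolding entire2_def
proof
  fix P
  from assms obtain D E where
    D: "((\<lambda>(Z, Z'). F Z Z') has_derivative D) (at P)" "\<And>c V V'. D (cscale c V, cscale c V') = c * D (V, V')" and
    E: "((\<lambda>(Z, Z'). G Z Z') has_derivative E) (at P)" "\<And>c V V'. E (cscale c V, cscale c V') = c * E (V, V')"
    unfolding entire2_def by meson
  have "((\<lambda>(Z, Z'). F Z Z' * G Z Z') has_derivative
      (\<lambda>V. F (fst P) (snd P) * E V + D V * G (fst P) (snd P))) (at P)"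
    using has_derivative_mult[OF D(1) E(1)] by (simp add: case_prod_beta')
  then show "\<exists>D. ((\<lambda>(Z, Z'). F Z Z' * G Z Z') has_derivative D) (at P) \<and>
      (\<forall>c V V'. D (cscale c V, cscale c V') = c * D (V, V'))"
    using D(2) E(2) by (intro exI conjI) (assumption, simp add: algebra_simps)
qed

lemma entire2_sum:
  assumes "\<And>a. a \<in> A \<Longrightarrow> entire2 (F a)"
  shows "entire2 (\<lambda>Z Z'. \<Sum>a\<in>A. F a Z Z')"
  using assms by (induction A rule: infinite_finite_induct) (auto intro: entire2_const entire2_add)

lemma entire2_exp:
  assumes "entire2 F"
  shows "entire2 (\<lambda>Z Z'. exp (F Z Z'))"
  unfolding entire2_def
proof
  fix P
  from assms obtain D where
    D: "((\<lambda>(Z, Z'). F Z Z') has_derivative D) (at P)" "\<And>c V V'. D (cscale c V, cscale c V') = c * D (V, V')"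
    unfolding entire2_def by meson
  have "((\<lambda>(Z, Z'). exp (F Z Z')) has_derivative (\<lambda>V. exp (F (fst P) (snd P)) * D V)) (at P)"
    using has_derivative_in_compose[OF D(1) has_field_derivative_imp_has_derivative[OF DERIV_subset[OF DERIV_exp subset_UNIV]]]
    by (simp add: case_prod_beta')
  then show "\<exists>D. ((\<lambda>(Z, Z'). exp (F Z Z')) has_derivative D) (at P) \<and>
      (\<forall>c V V'. D (cscale c V, cscale c V') = c * D (V, V'))"
    using D(2) by (intro exI conjI) (assumption, simp add: algebra_simps)
qed

text \<open>
  With \<open>\<gamma> t = (A + t B, cnj A + t cnj B)\<close> every point is \<open>\<gamma> \<i>\<close> for suitable \<open>A, B\<close>, while for real \<open>t\<close>
  the curve stays in \<open>{(Z, cnj Z)}\<close>; the identity theorem in the single variable \<open>t\<close> then applies.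
\<close>

lemma entire2_eq_0I:
  fixes F :: "complex^'d^'n \<Rightarrow> complex^'d^'n \<Rightarrow> complex"
  assumes "entire2 F" and zero: "\<And>Z. F Z (cnj_vec Z) = 0"
  shows "F Z Z' = 0"
proof -
  \<comment> \<open>These solve \<open>A + \<i> B = Z\<close> and
    \<open>A - \<i> B = cnj Z'\<close>, the second being the conjugate of the condition on the other
    component.\<close>
  define A where "A = cscale (1 / 2) (Z + cnj_vec Z')"
  define B where "B = cscale (- (\<i> / 2)) (Z - cnj_vec Z')"
  define \<gamma> where "\<gamma> t = (A + cscale t B, cnj_vec A + cscale t (cnj_vec B))" for t
  define H where "H t = F (fst (\<gamma> t)) (snd (\<gamma> t))" for t
  have deriv_\<gamma>: "(\<gamma> has_derivative (\<lambda>s. (cscale s B, cscale s (cnj_vec B)))) (at t)" for t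
  proof -
    have "((\<lambda>t. cscale t C) has_derivative (\<lambda>s. cscale s C)) (at t)" for C :: "complex^'d^'n"
    proof -
      have "linear (\<lambda>t. cscale t C)"
        by (rule linearI) (auto simp: cscale_def vec_eq_iff algebra_simps)
      then show ?thesis
        by (simp add: linear_linear bounded_linear_imp_has_derivative)
    qed
    note * = this
    show ?thesis unfolding \<gamma>_def
      by (rule has_derivative_eq_rhs[OF has_derivative_Pair[OF
            has_derivative_add[OF has_derivative_const *] has_derivative_add[OF has_derivative_const *]]]) simp
  qed
  have "H field_differentiable (at t)" for t
  proof -
    from assms(1) obtain D where
      D: "((\<lambda>(Z, Z'). F Z Z') has_derivative D) (at (\<gamma> t))" "\<And>c V V'. D (cscale c V, cscale c V') = c * D (V, V')"
      unfolding entire2_def by meson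
    \<comment> \<open>Complex linearity of \<open>D\<close> pulls the scalar \<open>s\<close> out,
      which turns the real derivative of \<open>H\<close> into a complex one.\<close>
    have "(H has_derivative (\<lambda>s. D (B, cnj_vec B) * s)) (at t)"
      using has_derivative_compose[OF deriv_\<gamma> D(1)] D(2) by (simp add: H_def[abs_def] case_prod_beta' mult.commute)
    then show ?thesis
      by (auto simp: field_differentiable_def has_field_derivative_def)
  qed
  then have "H holomorphic_on UNIV"
    by (simp add: holomorphic_on_def field_differentiable_at_within)
  moreover have "H t = 0" if "t \<in> \<real>" for t
  proof -
    have "snd (\<gamma> t) = cnj_vec (fst (\<gamma> t))"
      using that by (auto simp: \<gamma>_def cnj_vec_def cscale_def vec_eq_iff Reals_cnj_iff)
    then show ?thesis by (simp add: H_def zero)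
  qed
  moreover have "0 islimpt (\<real> :: complex set)"
  proof (subst islimpt_approachable, intro allI impI)
    fix e :: real assume "e > 0"
    then show "\<exists>x'\<in>\<real>. x' \<noteq> 0 \<and> dist x' (0::complex) < e"
      by (intro bexI[of _ "of_real (e / 2)"]) auto
  qed
  ultimately have "H \<i> = 0"
    using analytic_continuation[of H UNIV "\<real>" 0 \<i>] by auto
  moreover have "\<gamma> \<i> = (Z, Z')"
    by (auto simp: \<gamma>_def A_def B_def cnj_vec_def cscale_def vec_eq_iff field_simps)
  ultimately show ?thesis by (simp add: H_def)
qed

text \<open>This evaluates the definite description: the difference of two candidates is entire and
  vanishes on all pairs \<open>(Z, cnj_vec Z)\<close>, hence everywhere.\<close>

lemma husimi_ext_eqI:
  assumes "entire2 F" and "\<And>Z. F Z (cnj_vec Z) = husimi hbar T Z"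
  shows "husimi_ext hbar T = F"
  unfolding husimi_ext_def
proof (rule the_equality)
  fix G assume G: "entire2 G \<and> (\<forall>Z. G Z (cnj_vec Z) = husimi hbar T Z)"
  have "entire2 (\<lambda>Z Z'. G Z Z' + (- 1) * F Z Z')"
    using assms G by (intro entire2_add entire2_mult entire2_const) auto
  from entire2_eq_0I[OF this] show "G = F"
    using assms(2) G by (fastforce simp: fun_eq_iff)
qed (use assms in auto)

section \<open>Exchange of two particles as a measure-preserving involution\<close>

lemma linear_exchange: "linear (exchange i j :: 'a::real_vector^'n \<Rightarrow> _)"
  by (rule linearI) (auto simp: exchange_def vec_eq_iff)

lemma exchange_exchange [simp]: "exchange i j (exchange i j X) = X"
  by (simp add: exchange_def vec_eq_iff)

text \<open>Reindexing by the transposition, its own inverse. The general \<open>f\<close> covers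
  the real inner product, \<open>real_dot\<close> and \<open>complex_dot\<close> at once.\<close>

lemma sum_exchange:
  fixes f :: "'a \<Rightarrow> 'b \<Rightarrow> 'c::comm_monoid_add" and X :: "'a^'n"
  shows "(\<Sum>l\<in>UNIV. f (exchange i j X $ l) (Y $ l)) = (\<Sum>l\<in>UNIV. f (X $ l) (exchange i j Y $ l))"
  by (rule sum.reindex_bij_witness[of _ "Transposition.transpose i j" "Transposition.transpose i j"])
    (auto simp: exchange_def)

lemma inner_exchange:
  fixes X Y :: "'a::real_inner^'n"
  shows "exchange i j X \<bullet> Y = X \<bullet> exchange i j Y"
  unfolding inner_vec_def by (rule sum_exchange)

lemma norm_exchange [simp]:
  fixes X :: "'a::real_inner^'n"
  shows "norm (exchange i j X) = norm X"
  by (simp add: norm_eq_sqrt_inner inner_exchange)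

text \<open>Axis vectors go to axis vectors; one inclusion gives equality because the exchange is an
  involution.\<close>

lemma exchange_Basis: "exchange i j ` (Basis :: ('a::euclidean_space^'n) set) = Basis"
proof -
  have ax: "exchange i j (axis l b) = axis (Transposition.transpose i j l) b" for l and b :: 'a
    by (auto simp: exchange_def axis_def vec_eq_iff Transposition.transpose_eq_iff)
  then have "exchange i j x \<in> Basis" if "x \<in> Basis" for x :: "'a^'n"
    using that by (auto simp: Basis_vec_def)
  then show ?thesis
    by (metis exchange_exchange imageI image_subsetI subsetI subset_antisym)
qed

lemma lborel_distr_exchange:
  "distr lborel borel (exchange i j) = (lborel :: ('a::euclidean_space^'n) measure)"
  by (intro lborel_distr_permute_Basis linear_exchange exchange_exchange inner_exchange exchange_Basis)

lemma measurable_exchange [measurable]: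
  "(exchange i j :: 'a::euclidean_space^'n \<Rightarrow> _) \<in> borel_measurable borel"
  using linear_exchange by (intro borel_measurable_continuous_onI linear_continuous_on)
    (simp add: linear_linear)

lemma integral_exchange:
  fixes f :: "'a::euclidean_space^'n \<Rightarrow> complex"
  assumes "f \<in> borel_measurable borel"
  shows "(LINT X|lborel. f (exchange i j X)) = (LINT X|lborel. f X)"
  using integral_distr[of "exchange i j" lborel borel f] assms
  by (simp add: lborel_distr_exchange)

section \<open>Coherent states and their holomorphic part\<close>

text \<open>
  The coherent state at \<open>Z\<close>, up to a positive factor depending on \<open>Z\<close>; unlike the coherent state it is
  holomorphic in \<open>Z\<close>.
\<close>

definition gauss_wave :: "real \<Rightarrow> complex^'d^'n \<Rightarrow> (real^'d^'n) wavefun" where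
  "gauss_wave hbar Z x = exp ((real_dot x Z - of_real ((norm x)\<^sup>2 / 2)) / of_real hbar)"

text \<open>One integral over the product space rather than an iterated one, so that
  \<open>has_derivative_exp_integral\<close> applies directly; Fubini is postponed to
  \<open>coherent_pairing\<close>.\<close>

definition husimi_form ::
  "real \<Rightarrow> (real^'d^'n) kernel \<Rightarrow> complex^'d^'n \<Rightarrow> complex^'d^'n \<Rightarrow> complex" where
  "husimi_form hbar K Z Z' = (LINT p|lborel.
     gauss_wave hbar Z' (fst p) * K (fst p) (snd p) * gauss_wave hbar Z (snd p))"

text \<open>The part of the coherent state that is not holomorphic in \<open>Z\<close>. It sees
  \<open>Z\<close> only through \<open>norm (Re_vec Z)\<close>, hence ignores exchanges.\<close>

definition coherent_const :: "real \<Rightarrow> complex^'d^'n \<Rightarrow> real" where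
  "coherent_const hbar Z = (pi * hbar) powr (- (real (CARD('d) * CARD('n)) / 4)) *
     exp (- ((norm (Re_vec Z))\<^sup>2 / (2 * hbar)))"

lemma Re_real_dot: "Re (real_dot x Z) = x \<bullet> Re_vec Z"
  by (simp add: real_dot_def Re_vec_def inner_vec_def)

lemma Im_real_dot: "Im (real_dot x Z) = x \<bullet> Im_vec Z"
  by (simp add: real_dot_def Im_vec_def inner_vec_def)

lemma real_dot_add: "real_dot x (Z + W) = real_dot x Z + real_dot x W"
  by (simp add: real_dot_def sum.distrib algebra_simps)

lemma real_dot_scaleR: "real_dot x (c *\<^sub>R Z) = c *\<^sub>R real_dot x Z"
  by (simp add: real_dot_def scaleR_sum_right)

lemma real_dot_cscale: "real_dot x (cscale c Z) = c * real_dot x Z"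
  by (simp add: real_dot_def cscale_def sum_distrib_left mult.left_commute)

lemma real_dot_cnj_vec: "real_dot x (cnj_vec Z) = cnj (real_dot x Z)"
  by (simp add: real_dot_def cnj_vec_def)

lemma continuous_on_real_dot [continuous_intros]:
  "continuous_on S f \<Longrightarrow> continuous_on S (\<lambda>u. real_dot (f u) Z)"
  unfolding real_dot_def by (intro continuous_intros)

lemma real_dot_exchange: "real_dot (exchange i j x) Z = real_dot x (exchange i j Z)"
  unfolding real_dot_def by (rule sum_exchange[of "\<lambda>a b. \<Sum>k\<in>UNIV. of_real (a $ k) * b $ k"])

text \<open>A crude constant suffices: what matters for domination is linear growth in
  \<open>norm x\<close> and in \<open>norm Z\<close>.\<close>

lemma norm_real_dot_le:
  fixes x :: "real^'d^'n" and Z :: "complex^'d^'n"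
  shows "norm (real_dot x Z) \<le> real (CARD('n) * CARD('d)) * norm x * norm Z"
proof -
  have "norm (of_real (x $ l $ k) * Z $ l $ k) \<le> norm x * norm Z" for l :: 'n and k :: 'd
  proof -
    have "\<bar>x $ l $ k\<bar> \<le> norm x"
      using Finite_Cartesian_Product.norm_nth_le[of "x $ l" k] Finite_Cartesian_Product.norm_nth_le[of x l] by simp
    moreover have "norm (Z $ l $ k) \<le> norm Z"
      using Finite_Cartesian_Product.norm_nth_le[of "Z $ l" k] Finite_Cartesian_Product.norm_nth_le[of Z l] by simp
    ultimately show ?thesis unfolding norm_mult by (intro mult_mono) auto
  qed
  then have "norm (real_dot x Z) \<le> (\<Sum>l\<in>(UNIV::'n set). \<Sum>k\<in>(UNIV::'d set). norm x * norm Z)"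
    unfolding real_dot_def by (intro sum_norm_le)
  then show ?thesis by simp
qed

text \<open>In the expanded square, the cross term and the phase are the real and imaginary parts of
  \<open>real_dot x Z / hbar\<close>.\<close>

lemma coherent_state_eq:
  fixes Z :: "complex^'d^'n"
  shows "coherent_state hbar Z x = of_real (coherent_const hbar Z) * gauss_wave hbar Z x"
proof -
  have "(norm (x - Re_vec Z))\<^sup>2 = (norm x)\<^sup>2 - 2 * (x \<bullet> Re_vec Z) + (norm (Re_vec Z))\<^sup>2"
    by (simp add: power2_norm_eq_inner inner_diff_left inner_diff_right inner_commute)
  then have "of_real (- ((norm (x - Re_vec Z))\<^sup>2 / (2 * hbar))) + \<i> * of_real ((Im_vec Z \<bullet> x) / hbar) =
      of_real (- ((norm (Re_vec Z))\<^sup>2 / (2 * hbar))) +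
      (real_dot x Z - of_real ((norm x)\<^sup>2 / 2)) / of_real hbar"
    by (simp add: complex_eq_iff Re_real_dot Im_real_dot inner_commute Re_divide_of_real Im_divide_of_real
        add_divide_distrib diff_divide_distrib)
  then have "exp (of_real (- ((norm (x - Re_vec Z))\<^sup>2 / (2 * hbar)))) * exp (\<i> * of_real ((Im_vec Z \<bullet> x) / hbar)) =
      exp (of_real (- ((norm (Re_vec Z))\<^sup>2 / (2 * hbar)))) * gauss_wave hbar Z x"
    unfolding gauss_wave_def exp_add[symmetric] by simp
  then show ?thesis
    unfolding coherent_state_def coherent_const_def exp_of_real of_real_mult by (simp only: mult.assoc)
qed

lemma cnj_gauss_wave: "cnj (gauss_wave hbar Z x) = gauss_wave hbar (cnj_vec Z) x"
  by (simp add: gauss_wave_def exp_cnj real_dot_cnj_vec)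

lemma borel_measurable_gauss_wave [measurable]: "gauss_wave hbar Z \<in> borel_measurable borel"
  unfolding gauss_wave_def[abs_def] divide_inverse
  by (intro borel_measurable_continuous_onI continuous_intros)

lemma gauss_wave_exchange: "gauss_wave hbar Z (exchange i j x) = gauss_wave hbar (exchange i j Z) x"
  by (simp add: gauss_wave_def real_dot_exchange)

lemma Re_vec_exchange: "Re_vec (exchange i j Z) = exchange i j (Re_vec Z)"
  by (simp add: Re_vec_def exchange_def vec_eq_iff)

lemma coherent_const_exchange: "coherent_const hbar (exchange i j Z) = coherent_const hbar Z"
  by (simp add: coherent_const_def Re_vec_exchange)

lemma coherent_state_exchange:
  "coherent_state hbar Z (exchange i j x) = coherent_state hbar (exchange i j Z) x"
  by (simp add: coherent_state_eq gauss_wave_exchange coherent_const_exchange)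

lemma borel_measurable_coherent_state [measurable]: "coherent_state hbar Z \<in> borel_measurable borel"
  unfolding coherent_state_eq[abs_def] by measurable

text \<open>An operator is compared with its kernel only on \<open>L2\<close>. By Cauchy-Schwarz,
  the squared modulus is at most a Gaussian times an exponential of \<open>norm x\<close>.\<close>

lemma coherent_state_L2:
  assumes "hbar > 0"
  shows "coherent_state hbar Z \<in> L2"
proof -
  have "integrable lborel (\<lambda>x. (cmod (gauss_wave hbar Z x))\<^sup>2)"
  proof (rule Bochner_Integration.integrable_bound)
    show "integrable lborel (\<lambda>x::real^'a^'b. exp (2 * norm (Re_vec Z) / hbar * norm x - 1 / hbar * (norm x)\<^sup>2))"
      using assms by (intro integrable_gaussian_exp_norm) auto
    have "(cmod (gauss_wave hbar Z x))\<^sup>2 \<le> exp (2 * norm (Re_vec Z) / hbar * norm x - 1 / hbar * (norm x)\<^sup>2)" for x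
    proof -
      have "(cmod (gauss_wave hbar Z x))\<^sup>2 = exp ((2 * (x \<bullet> Re_vec Z) - (norm x)\<^sup>2) / hbar)"
        using assms by (simp add: gauss_wave_def exp_double[symmetric] Re_real_dot Re_divide_of_real field_simps)
      also have "\<dots> \<le> exp ((2 * (norm x * norm (Re_vec Z)) - (norm x)\<^sup>2) / hbar)"
        using assms norm_cauchy_schwarz[of x "Re_vec Z"] by (simp add: divide_right_mono)
      finally show ?thesis using assms by (simp add: diff_divide_distrib mult.commute mult.left_commute)
    qed
    then show "AE x in lborel. norm ((cmod (gauss_wave hbar Z x))\<^sup>2) \<le>
        norm (exp (2 * norm (Re_vec Z) / hbar * norm x - 1 / hbar * (norm x)\<^sup>2))"
      by simp
  qed measurable
  then show ?thesis
    by (simp add: L2_def coherent_state_eq norm_mult power_mult_distrib)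
qed

text \<open>The two Gaussians merge into one in the norm of the pair \<open>p\<close>; what remains
  is the exponential of a form linear in \<open>(Z, Z')\<close>, as
  \<open>has_derivative_exp_integral\<close> expects.\<close>

lemma gauss_wave_mult:
  assumes "hbar > 0"
  shows "gauss_wave hbar Z' (fst p) * k * gauss_wave hbar Z (snd p) =
    k * of_real (exp (- ((norm p)\<^sup>2 / (2 * hbar)))) *
    exp ((real_dot (snd p) Z + real_dot (fst p) Z') / of_real hbar)"
proof -
  have "(norm p)\<^sup>2 = (norm (fst p))\<^sup>2 + (norm (snd p))\<^sup>2"
    by (simp add: norm_prod_def)
  then have "(real_dot (fst p) Z' - of_real ((norm (fst p))\<^sup>2 / 2)) / of_real hbar +
      (real_dot (snd p) Z - of_real ((norm (snd p))\<^sup>2 / 2)) / of_real hbar =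
      of_real (- ((norm p)\<^sup>2 / (2 * hbar))) + (real_dot (snd p) Z + real_dot (fst p) Z') / of_real hbar"
    using assms by (simp add: field_simps)
  then have *: "gauss_wave hbar Z' (fst p) * gauss_wave hbar Z (snd p) =
      of_real (exp (- ((norm p)\<^sup>2 / (2 * hbar)))) *
      exp ((real_dot (snd p) Z + real_dot (fst p) Z') / of_real hbar)"
    unfolding gauss_wave_def exp_of_real[symmetric] exp_add[symmetric] by simp
  have "gauss_wave hbar Z' (fst p) * k * gauss_wave hbar Z (snd p) =
      k * (gauss_wave hbar Z' (fst p) * gauss_wave hbar Z (snd p))"
    by (simp only: ac_simps)
  then show ?thesis by (simp only: * mult.assoc)
qed

lemma norm_pair_real_dot_le:
  fixes p :: "(real^'d^'n) \<times> (real^'d^'n)"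
  assumes "hbar > 0"
  shows "norm ((real_dot (snd p) (fst W) + real_dot (fst p) (snd W)) / of_real hbar)
    \<le> 2 * real (CARD('n) * CARD('d)) / hbar * norm p * norm W"
proof -
  have le: "norm (fst q) \<le> norm q" "norm (snd q) \<le> norm q" for q :: "'b::real_normed_vector \<times> 'c::real_normed_vector"
    using norm_fst_le[of "fst q" "snd q"] norm_snd_le[of "snd q" "fst q"] by auto
  have "norm (real_dot x Z) \<le> real (CARD('n) * CARD('d)) * norm p * norm W"
    if "norm x \<le> norm p" "norm Z \<le> norm W" for x :: "real^'d^'n" and Z
    using that by (intro order_trans[OF norm_real_dot_le] mult_mono) auto
  from this[of "snd p" "fst W"] this[of "fst p" "snd W"]
  have "norm (real_dot (snd p) (fst W) + real_dot (fst p) (snd W))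
      \<le> 2 * (real (CARD('n) * CARD('d)) * norm p * norm W)"
    using norm_triangle_ineq[of "real_dot (snd p) (fst W)" "real_dot (fst p) (snd W)"] le[of p] le[of W]
    by linarith
  then show ?thesis
    using assms by (simp add: norm_divide divide_right_mono)
qed

section \<open>The double integral against a square-integrable kernel\<close>

context
  fixes hbar :: real and K :: "(real^'d^'n) kernel"
  assumes hbar: "hbar > 0" and K: "(\<lambda>(X, Y). K X Y) \<in> L2"
begin

lemma borel_measurable_kernel: "(\<lambda>p. K (fst p) (snd p)) \<in> borel_measurable borel"
  using K by (simp add: L2_def case_prod_beta')

text \<open>A product of two square-integrable functions: the squared weight has linear rate
  \<open>2 * c\<close> and Gaussian rate \<open>1 / hbar\<close>.\<close>

lemma integrable_kernel_gaussian:
  "integrable lborel (\<lambda>p. norm (K (fst p) (snd p) * of_real (exp (- ((norm p)\<^sup>2 / (2 * hbar))))) * exp (c * norm p))"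
proof -
  note borel_measurable_kernel[measurable]
  have "(\<lambda>p::(real^'d^'n) \<times> (real^'d^'n). complex_of_real (exp (c * norm p - 1 / (2 * hbar) * (norm p)\<^sup>2))) \<in> L2"
    using integrable_gaussian_exp_norm[of "1 / hbar" "2 * c", where 'a = "(real^'d^'n) \<times> (real^'d^'n)"] hbar
    by (simp add: L2_def exp_double[symmetric] algebra_simps)
  from integrable_norm[OF integrable_L2_mult[OF K this]] show ?thesis
    by (simp add: case_prod_beta' norm_mult mult.assoc exp_add[symmetric] add.commute)
qed

lemma integrable_husimi_form:
  "integrable lborel (\<lambda>p. gauss_wave hbar Z' (fst p) * K (fst p) (snd p) * gauss_wave hbar Z (snd p))"
proof (rule Bochner_Integration.integrable_bound)
  note borel_measurable_kernel[measurable]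
  let ?M = "2 * real (CARD('n) * CARD('d)) / hbar * norm (Z, Z')"
  show "integrable lborel (\<lambda>p. norm (K (fst p) (snd p) * of_real (exp (- ((norm p)\<^sup>2 / (2 * hbar))))) *
      exp (?M * norm p))"
    by (rule integrable_kernel_gaussian)
  have [measurable]: "(\<lambda>p. gauss_wave hbar Z' (fst p)) \<in> borel_measurable borel"
    "(\<lambda>p. gauss_wave hbar Z (snd p)) \<in> borel_measurable borel"
    by (intro measurable_compose[OF _ borel_measurable_gauss_wave] borel_measurable_continuous_onI
        continuous_intros)+
  show "(\<lambda>p. gauss_wave hbar Z' (fst p) * K (fst p) (snd p) * gauss_wave hbar Z (snd p)) \<in> borel_measurable lborel"
    by measurable
  have "norm (exp ((real_dot (snd p) Z + real_dot (fst p) Z') / of_real hbar)) \<le> exp (?M * norm p)" for p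
  proof (rule order_trans[OF norm_exp])
    show "exp (norm ((real_dot (snd p) Z + real_dot (fst p) Z') / of_real hbar)) \<le> exp (?M * norm p)"
      using norm_pair_real_dot_le[OF hbar, of p "(Z, Z')"]
      by (simp only: fst_conv snd_conv exp_le_cancel_iff ac_simps)
  qed
  then show "AE p in lborel. norm (gauss_wave hbar Z' (fst p) * K (fst p) (snd p) * gauss_wave hbar Z (snd p)) \<le>
      norm (norm (K (fst p) (snd p) * of_real (exp (- ((norm p)\<^sup>2 / (2 * hbar))))) * exp (?M * norm p))"
    unfolding gauss_wave_mult[OF hbar] norm_mult by (intro AE_I2) (auto intro!: mult_left_mono)
qed

text \<open>\<open>g\<close> absorbs the kernel and the Gaussian. The derivative under the integral
  is complex linear because each \<open>L p\<close> is.\<close>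

lemma entire2_husimi_form: "entire2 (husimi_form hbar K)"
  unfolding entire2_def
proof (intro allI exI conjI)
  note borel_measurable_kernel[measurable]
  fix P :: "(complex^'d^'n) \<times> (complex^'d^'n)"
  define g where "g p = K (fst p) (snd p) * of_real (exp (- ((norm p)\<^sup>2 / (2 * hbar))))" for p
  define L where "L p W = (real_dot (snd p) (fst W) + real_dot (fst p) (snd W)) / of_real hbar"
    for p :: "(real^'d^'n) \<times> (real^'d^'n)" and W
  define D where "D V = (LINT p|lborel. g p * L p V * exp (L p P))" for V
  have eq: "(\<lambda>(Z, Z'). husimi_form hbar K Z Z') = (\<lambda>W. LINT p|lborel. g p * exp (L p W))"
    by (simp add: husimi_form_def gauss_wave_mult[OF hbar] g_def L_def case_prod_beta')
  show "((\<lambda>(Z, Z'). husimi_form hbar K Z Z') has_derivative D) (at P)"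
    unfolding eq D_def
  proof (rule has_derivative_exp_integral[where N = "\<lambda>p. 2 * real (CARD('n) * CARD('d)) / hbar * norm p"])
    show "g \<in> borel_measurable lborel" unfolding g_def by measurable
    show "(\<lambda>p. L p W) \<in> borel_measurable lborel" for W
      unfolding L_def divide_inverse measurable_lborel2
      by (intro borel_measurable_continuous_onI continuous_intros)
    show "linear (L p)" for p
      by (rule linearI) (simp_all add: L_def real_dot_add real_dot_scaleR scaleR_add_right
          divide_inverse distrib_right)
    show "norm (L p W) \<le> 2 * real (CARD('n) * CARD('d)) / hbar * norm p * norm W" for p W
      unfolding L_def by (rule norm_pair_real_dot_le[OF hbar])
    show "integrable lborel (\<lambda>p. norm (g p) * exp (c * (2 * real (CARD('n) * CARD('d)) / hbar * norm p)))" for c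
      unfolding g_def mult.assoc[symmetric] by (rule integrable_kernel_gaussian)
  qed measurable
  fix c V V'
  have "L p (cscale c V, cscale c V') = c * L p (V, V')" for p
    by (simp add: L_def real_dot_cscale algebra_simps add_divide_distrib)
  then show "D (cscale c V, cscale c V') = c * D (V, V')"
    by (simp add: D_def mult.left_commute mult.assoc)
qed

lemma borel_measurable_kernel_operator:
  assumes [measurable]: "f \<in> borel_measurable borel"
  shows "kernel_operator K f \<in> borel_measurable borel"
proof -
  \<comment> \<open>The rule for parameter integrals wants \<open>lborel\<close> on the integration
    variable; the sigma-algebra is the same as for \<open>borel\<close>.\<close>
  have [measurable]: "(\<lambda>p. K (fst p) (snd p)) \<in> borel_measurable (borel \<Otimes>\<^sub>M lborel)"
    using borel_measurable_kernel unfolding borel_prod[symmetric]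
    by (simp cong: measurable_cong_sets sets_pair_measure_cong)
  have "(\<lambda>p. K (fst p) (snd p) * f (snd p)) \<in> borel_measurable (borel \<Otimes>\<^sub>M lborel)"
    by measurable
  then have "(\<lambda>(X, Y). K X Y * f Y) \<in> borel_measurable (borel \<Otimes>\<^sub>M lborel)"
    by (simp add: case_prod_beta')
  from lborel.borel_measurable_lebesgue_integral[OF this] show ?thesis
    by (simp add: kernel_operator_def[abs_def])
qed

text \<open>By Fubini. \<open>Z\<close> and \<open>W\<close> are kept apart because an exchange will
  act on only one of the two coherent states.\<close>

lemma coherent_pairing:
  "l2_inner (coherent_state hbar Z) (kernel_operator K (coherent_state hbar W)) =
   of_real (coherent_const hbar Z * coherent_const hbar W) * husimi_form hbar K W (cnj_vec Z)"
proof -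
  have "cnj (coherent_state hbar Z X) * kernel_operator K (coherent_state hbar W) X =
      of_real (coherent_const hbar Z * coherent_const hbar W) *
      (LINT Y|lborel. gauss_wave hbar (cnj_vec Z) X * K X Y * gauss_wave hbar W Y)" for X
  proof -
    have "kernel_operator K (coherent_state hbar W) X =
        of_real (coherent_const hbar W) * (LINT Y|lborel. K X Y * gauss_wave hbar W Y)"
      by (simp add: kernel_operator_def coherent_state_eq mult.left_commute[of "K _ _"])
    then show ?thesis
      by (simp add: coherent_state_eq cnj_gauss_wave mult.assoc)
  qed
  then have "l2_inner (coherent_state hbar Z) (kernel_operator K (coherent_state hbar W)) =
      of_real (coherent_const hbar Z * coherent_const hbar W) *
      (LINT X|lborel. LINT Y|lborel. gauss_wave hbar (cnj_vec Z) X * K X Y * gauss_wave hbar W Y)"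
    by (simp add: l2_inner_def)
  also have "(LINT X|lborel. LINT Y|lborel. gauss_wave hbar (cnj_vec Z) X * K X Y * gauss_wave hbar W Y) =
      husimi_form hbar K W (cnj_vec Z)"
    using lborel_pair.integral_fst'[OF integrable_husimi_form[unfolded lborel_prod[symmetric]], of "cnj_vec Z" W]
    by (simp add: husimi_form_def lborel_prod)
  finally show ?thesis .
qed

text \<open>Substitution in the inner variable \<open>Y\<close>. It holds at every \<open>X\<close>,
  since a change of variables also matches the default value 0 of a divergent integral.\<close>

lemma U_exchange_coherent_state:
  "U_exchange i j K (coherent_state hbar Z) = kernel_operator K (coherent_state hbar (exchange i j Z))"
proof
  fix X
  have [measurable]: "K X \<in> borel_measurable borel"
    using measurable_Pair2[of "\<lambda>p. K (fst p) (snd p)" borel borel borel X] borel_measurable_kernel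
    by (simp add: borel_prod)
  show "U_exchange i j K (coherent_state hbar Z) X = kernel_operator K (coherent_state hbar (exchange i j Z)) X"
    using integral_exchange[of "\<lambda>Y. K X Y * coherent_state hbar (exchange i j Z) Y" i j]
    by (simp add: U_exchange_def kernel_operator_def coherent_state_exchange[symmetric])
qed

text \<open>Here the exchange acts on the output variable, so the substitution takes place in the
  inner product and reaches the left coherent state.\<close>

lemma l2_inner_V_exchange_coherent_state:
  "l2_inner (coherent_state hbar Z) (V_exchange i j K (coherent_state hbar W)) =
   l2_inner (coherent_state hbar (exchange i j Z)) (kernel_operator K (coherent_state hbar W))"
proof -
  have [measurable]: "kernel_operator K (coherent_state hbar W) \<in> borel_measurable borel"
    by (rule borel_measurable_kernel_operator) measurable
  have "V_exchange i j K f X = kernel_operator K f (exchange i j X)" for f X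
    by (simp add: V_exchange_def kernel_operator_def)
  moreover have "(\<lambda>X. cnj (coherent_state hbar (exchange i j Z) X) *
      kernel_operator K (coherent_state hbar W) X) \<in> borel_measurable borel"
    by (intro borel_measurable_times measurable_compose[OF _ borel_measurable_continuous_onI[OF continuous_on_cnj[OF continuous_on_id]]])
      measurable
  ultimately show ?thesis
    using integral_exchange[of "\<lambda>X. cnj (coherent_state hbar (exchange i j Z) X) *
        kernel_operator K (coherent_state hbar W) X" i j]
    by (simp add: l2_inner_def coherent_state_exchange)
qed

end

section \<open>Effect of an exchange on the complex quadratic form\<close>

lemma bilinear_dot_commute: "bilinear_dot a b = bilinear_dot b a"
  by (simp add: bilinear_dot_def mult.commute)

lemma bilinear_dot_add_left: "bilinear_dot (a + b) c = bilinear_dot a c + bilinear_dot b c"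
  by (simp add: bilinear_dot_def sum.distrib distrib_right)

lemma bilinear_dot_diff_left: "bilinear_dot (a - b) c = bilinear_dot a c - bilinear_dot b c"
  by (simp add: bilinear_dot_def sum_subtractf left_diff_distrib)

lemma bilinear_dot_diff_right: "bilinear_dot a (b - c) = bilinear_dot a b - bilinear_dot a c"
  by (simp add: bilinear_dot_def sum_subtractf right_diff_distrib)

lemma complex_dot_commute: "complex_dot Z W = complex_dot W Z"
  by (simp add: complex_dot_def bilinear_dot_commute)

lemma complex_dot_add_left: "complex_dot (Z + Y) W = complex_dot Z W + complex_dot Y W"
  by (simp add: complex_dot_def bilinear_dot_add_left sum.distrib)

lemma complex_dot_add_right: "complex_dot W (Z + Y) = complex_dot W Z + complex_dot W Y"
  by (simp only: complex_dot_commute[of W] complex_dot_add_left)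

lemma complex_dot_add_square:
  "complex_dot (Z + W) (Z + W) = complex_dot Z Z + 2 * complex_dot Z W + complex_dot W W"
  using complex_dot_commute[of W Z] by (simp add: complex_dot_add_left complex_dot_add_right)

lemma complex_dot_exchange: "complex_dot (exchange i j Z) W = complex_dot Z (exchange i j W)"
  unfolding complex_dot_def by (rule sum_exchange)

text \<open>For distinct \<open>i\<close> and \<open>j\<close>, \<open>exchange i j Z - Z\<close>
  vanishes outside these two entries, where it takes opposite values.\<close>

lemma complex_dot_exchange_eq:
  "complex_dot (exchange i j Z) W = complex_dot Z W - bilinear_dot (Z $ i - Z $ j) (W $ i - W $ j)"
proof (cases "i = j")
  case True
  then show ?thesis by (simp add: exchange_def complex_dot_def bilinear_dot_def)
next
  case False
  have "complex_dot (exchange i j Z) W - complex_dot Z W =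
      (\<Sum>l\<in>UNIV. bilinear_dot (exchange i j Z $ l - Z $ l) (W $ l))"
    by (simp add: complex_dot_def bilinear_dot_diff_left sum_subtractf)
  also have "\<dots> = (\<Sum>l\<in>{i, j}. bilinear_dot (exchange i j Z $ l - Z $ l) (W $ l))"
    by (rule sum.mono_neutral_right) (auto simp: exchange_def bilinear_dot_def)
  also have "\<dots> = - bilinear_dot (Z $ i - Z $ j) (W $ i - W $ j)"
    using False by (simp add: exchange_def bilinear_dot_diff_left bilinear_dot_diff_right)
  finally show ?thesis by (simp add: algebra_simps)
qed

text \<open>Both pure squares are invariant, so only the cross term contributes.\<close>

lemma complex_dot_exchange_square:
  "complex_dot (exchange i j Z + W) (exchange i j Z + W) =
   complex_dot (Z + W) (Z + W) - 2 * bilinear_dot (Z $ i - Z $ j) (W $ i - W $ j)"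
proof -
  have "complex_dot (exchange i j Z) (exchange i j Z) = complex_dot Z Z"
    by (simp add: complex_dot_exchange)
  then show ?thesis
    by (simp add: complex_dot_add_square complex_dot_exchange_eq[of i j Z W] right_diff_distrib)
qed

text \<open>As \<open>Re_vec Z\<close> is half of \<open>Z + cnj_vec Z\<close>, the right-hand side
  is a polynomial that continues to independent \<open>Z\<close> and \<open>Z'\<close>.\<close>

lemma norm_Re_vec_square:
  "complex_of_real ((norm (Re_vec Z))\<^sup>2) = complex_dot (Z + cnj_vec Z) (Z + cnj_vec Z) / 4"
proof -
  have "(z + cnj z) * (z + cnj z) / 4 = of_real (Re z) * of_real (Re z)" for z
    by (simp add: complex_add_cnj)
  note * = this
  show ?thesis
    by (simp add: power2_norm_eq_inner inner_vec_def complex_dot_def bilinear_dot_def Re_vec_def cnj_vec_def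
        sum_divide_distrib *)
qed

text \<open>Identifies the real Gaussian factor of the \<open>V_exchange\<close> formula with the
  bilinear one of the \<open>U_exchange\<close> formula.\<close>

lemma norm_square_eq_bilinear_dot:
  "complex_of_real ((norm (Z $ i - Z $ j))\<^sup>2) =
   bilinear_dot (cnj_vec Z $ i - cnj_vec Z $ j) (Z $ i - Z $ j)"
proof -
  have "(norm w)\<^sup>2 = (\<Sum>k\<in>UNIV. (cmod (w $ k))\<^sup>2)" for w :: "complex^'a"
    by (simp add: norm_vec_def L2_set_def sum_nonneg)
  then show ?thesis
    by (simp add: bilinear_dot_def cnj_vec_def complex_norm_square mult.commute del: of_real_power)
qed

lemma cnj_vec_exchange: "cnj_vec (exchange i j Z) = exchange i j (cnj_vec Z)"
  by (simp add: cnj_vec_def exchange_def vec_eq_iff)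

section \<open>The entire extension of the Husimi function and the exchange formulas\<close>

text \<open>The \<open>itself\<close> argument only carries the index types, whose cardinalities
  give the dimension.\<close>

definition husimi_const :: "real \<Rightarrow> (complex^'d^'n) itself \<Rightarrow> real" where
  "husimi_const hbar _ = ((pi * hbar) powr (- (real (CARD('d) * CARD('n)) / 4)))\<^sup>2 /
     (2 * pi * hbar) ^ (CARD('d) * CARD('n))"

definition husimi_entire ::
  "real \<Rightarrow> (real^'d^'n) kernel \<Rightarrow> complex^'d^'n \<Rightarrow> complex^'d^'n \<Rightarrow> complex" where
  "husimi_entire hbar K Z Z' =
     of_real (husimi_const hbar TYPE(complex^'d^'n)) *
     exp (of_real (- 1 / (4 * hbar)) * complex_dot (Z + Z') (Z + Z')) * husimi_form hbar K Z Z'"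

text \<open>The free factor \<open>w\<close> lets the same identity serve the original and the
  exchanged values of \<open>husimi_form\<close>.\<close>

lemma coherent_const_square:
  fixes Z :: "complex^'d^'n"
  shows "complex_of_real (coherent_const hbar Z * coherent_const hbar Z) * w /
      complex_of_real ((2 * pi * hbar) ^ (CARD('d) * CARD('n))) =
    of_real (husimi_const hbar TYPE(complex^'d^'n)) *
    exp (of_real (- 1 / (4 * hbar)) * complex_dot (Z + cnj_vec Z) (Z + cnj_vec Z)) * w"
proof -
  have "coherent_const hbar Z * coherent_const hbar Z / (2 * pi * hbar) ^ (CARD('d) * CARD('n)) =
      husimi_const hbar TYPE(complex^'d^'n) * exp (- (norm (Re_vec Z))\<^sup>2 / hbar)"
  proof -
    have "exp (- ((norm (Re_vec Z))\<^sup>2 / (2 * hbar))) * exp (- ((norm (Re_vec Z))\<^sup>2 / (2 * hbar))) =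
        exp (- (norm (Re_vec Z))\<^sup>2 / hbar)"
      unfolding exp_add[symmetric] by simp
    moreover have "(a * e) * (a * e) / m = a\<^sup>2 / m * (e * e)" for a e m :: real
      by (simp add: power2_eq_square)
    ultimately show ?thesis
      by (simp only: coherent_const_def husimi_const_def)
  qed
  moreover have exp_eq: "complex_of_real (exp (- (norm (Re_vec Z))\<^sup>2 / hbar)) =
      exp (of_real (- 1 / (4 * hbar)) * complex_dot (Z + cnj_vec Z) (Z + cnj_vec Z))"
    unfolding exp_of_real[symmetric] of_real_divide[of "- (norm (Re_vec Z))\<^sup>2"] of_real_minus norm_Re_vec_square
    by simp
  moreover have "complex_of_real x * w / complex_of_real m = complex_of_real (x / m) * w" for x m
    by simp
  ultimately have "complex_of_real (coherent_const hbar Z * coherent_const hbar Z) * w /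
      complex_of_real ((2 * pi * hbar) ^ (CARD('d) * CARD('n))) =
      complex_of_real (husimi_const hbar TYPE(complex^'d^'n) * exp (- (norm (Re_vec Z))\<^sup>2 / hbar)) * w"
    by (simp only:)
  then show ?thesis
    by (simp only: of_real_mult exp_eq)
qed

text \<open>\<open>T\<close> and the kernel operator agree almost everywhere on the coherent state,
  and both images are measurable, so the inner products coincide.\<close>

lemma husimi_eq_of_kernel:
  fixes Z :: "complex^'d^'n"
  assumes "hbar > 0" and "density_matrix T" and "has_integral_kernel T K"
  shows "husimi hbar T Z = husimi_entire hbar K Z (cnj_vec Z)"
proof -
  let ?\<phi> = "coherent_state hbar Z"
  have K: "(\<lambda>(X, Y). K X Y) \<in> L2" and ae: "AE X in lborel. T ?\<phi> X = kernel_operator K ?\<phi> X"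
    using assms(3) coherent_state_L2[OF assms(1), of Z] by (auto simp: has_integral_kernel_def)
  have [measurable]: "T ?\<phi> \<in> borel_measurable borel"
    using assms(2) coherent_state_L2[OF assms(1), of Z]
    by (auto simp: density_matrix_def positive_l2_operator_def bounded_l2_operator_def L2_def)
  have [measurable]: "kernel_operator K ?\<phi> \<in> borel_measurable borel"
    by (rule borel_measurable_kernel_operator[OF assms(1) K]) measurable
  have [measurable]: "(\<lambda>X. cnj (?\<phi> X)) \<in> borel_measurable borel"
    unfolding coherent_state_eq complex_cnj_mult cnj_gauss_wave by measurable
  have "l2_inner ?\<phi> (T ?\<phi>) = l2_inner ?\<phi> (kernel_operator K ?\<phi>)"
    unfolding l2_inner_def by (rule integral_cong_AE) (use ae in auto)
  then show ?thesis
    by (simp only: husimi_def coherent_pairing[OF assms(1) K] husimi_entire_def coherent_const_square)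
qed

lemma entire2_husimi_entire:
  assumes "hbar > 0" and "(\<lambda>(X, Y). K X Y) \<in> L2"
  shows "entire2 (husimi_entire hbar K)"
  unfolding husimi_entire_def[abs_def] complex_dot_def bilinear_dot_def vector_add_component
  by (intro entire2_mult entire2_const entire2_exp entire2_sum entire2_add
      entire2_component_fst entire2_component_snd entire2_husimi_form[OF assms])

theorem lemma3p1:
  fixes hbar :: real
    and \<rho> :: "(real^'d^'n) operator"
    and K :: "(real^'d^'n) kernel"
    and i j :: 'n
    and Z :: "complex^'d^'n"
  assumes "hbar > 0"
    and "density_matrix \<rho>"
    and "has_integral_kernel \<rho> K"
  shows "(husimi hbar (U_exchange i j K) Z =
           exp (- bilinear_dot (cnj_vec Z $ i - cnj_vec Z $ j) (Z $ i - Z $ j) / (2 * hbar)) *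
           husimi_ext hbar \<rho> (exchange i j Z) (cnj_vec Z)) \<and>
         (husimi hbar (V_exchange i j K) Z =
           exp (- (norm (Z $ i - Z $ j))\<^sup>2 / (2 * hbar)) *
           husimi_ext hbar \<rho> Z (exchange i j (cnj_vec Z)))"
proof -
  have K: "(\<lambda>(X, Y). K X Y) \<in> L2"
    using assms(3) by (simp add: has_integral_kernel_def)
  have ext: "husimi_ext hbar \<rho> = husimi_entire hbar K"
    by (intro husimi_ext_eqI entire2_husimi_entire assms(1) K husimi_eq_of_kernel[symmetric] assms)
  define b where "b = bilinear_dot (cnj_vec Z $ i - cnj_vec Z $ j) (Z $ i - Z $ j)"
  define s where "s = complex_dot (Z + cnj_vec Z) (Z + cnj_vec Z)"
  define c where "c = complex_of_real (husimi_const hbar TYPE(complex^'d^'n))"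
  have s_U: "complex_dot (exchange i j Z + cnj_vec Z) (exchange i j Z + cnj_vec Z) = s - 2 * b"
    by (simp add: complex_dot_exchange_square s_def b_def bilinear_dot_commute)
  \<comment> \<open>The form is symmetric in its two summands, so an exchange in the second argument
    is the previous case with the roles swapped.\<close>
  have s_V: "complex_dot (Z + exchange i j (cnj_vec Z)) (Z + exchange i j (cnj_vec Z)) = s - 2 * b"
    using complex_dot_exchange_square[of i j "cnj_vec Z" Z] by (simp add: s_def b_def add.commute)
  \<comment> \<open>The left side is the prefactor at the original point, which survives the
    exchange since \<open>coherent_const\<close> is invariant; the extension at exchanged arguments
    carries \<open>s - 2 * b\<close> instead.\<close>
  have exp_eq: "exp (of_real (- 1 / (4 * hbar)) * s) =
      exp (- b / of_real (2 * hbar)) * exp (of_real (- 1 / (4 * hbar)) * (s - 2 * b))"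
  proof -
    have "of_real (- 1 / (4 * hbar)) * s = - b / of_real (2 * hbar) + of_real (- 1 / (4 * hbar)) * (s - 2 * b)"
      using assms(1) by (simp add: field_simps)
    then show ?thesis by (simp only: exp_add)
  qed
  have "husimi hbar (U_exchange i j K) Z =
      c * exp (of_real (- 1 / (4 * hbar)) * s) * husimi_form hbar K (exchange i j Z) (cnj_vec Z)"
    by (simp only: husimi_def U_exchange_coherent_state[OF assms(1) K] coherent_pairing[OF assms(1) K]
        coherent_const_exchange coherent_const_square c_def s_def)
  also have "\<dots> = exp (- b / of_real (2 * hbar)) * husimi_ext hbar \<rho> (exchange i j Z) (cnj_vec Z)"
    by (simp only: ext husimi_entire_def s_U exp_eq c_def mult.assoc mult.left_commute)
  finally have U: "husimi hbar (U_exchange i j K) Z = \<dots>" .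
  have "husimi hbar (V_exchange i j K) Z =
      c * exp (of_real (- 1 / (4 * hbar)) * s) * husimi_form hbar K Z (exchange i j (cnj_vec Z))"
    by (simp only: husimi_def l2_inner_V_exchange_coherent_state[OF assms(1) K] coherent_pairing[OF assms(1) K]
        coherent_const_exchange cnj_vec_exchange coherent_const_square c_def s_def)
  also have "\<dots> = exp (- b / of_real (2 * hbar)) * husimi_ext hbar \<rho> Z (exchange i j (cnj_vec Z))"
    by (simp only: ext husimi_entire_def s_V exp_eq c_def mult.assoc mult.left_commute)
  also have "exp (- b / of_real (2 * hbar)) =
      complex_of_real (exp (- (norm (Z $ i - Z $ j))\<^sup>2 / (2 * hbar)))"
    unfolding b_def norm_square_eq_bilinear_dot[symmetric] exp_of_real[symmetric] by simp
  finally show ?thesis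
    using U by (simp only: b_def)
qed

end
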